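(* Let $X$ be a nonempty set and let $\mathcal{A}$ be a finite algebra of subsets of $X$ with $|\mathcal{A}|\ge 2^{4}$. Then there exists a family $\mathcal{H}$ of subsets of $X$ such that: (i) $\mathcal{H}\subseteq\mathcal{A}$; (ii) the elements of $\mathcal{H}$ form a partition of $X$; (iii) $\mathcal{H}$ is 1-minimal constructible; (iv) $C_\infty(\mathcal{H})=\mathcal{A}$; (v) $|\mathcal{H}|=\log_2|\mathcal{A}|$; (vi) with $n=|\mathcal{H}|$, $$S_{\mathcal{H}}(\mathcal{A})=\begin{cases}\lfloor \log_2 n\rfloor & \text{if } n\le 1+3\cdot 2^{\lfloor \log_2 n\rfloor-1},\\ \lceil \log_2 n\rceil & \text{if } n> 1+3\cdot 2^{\lfloor \log_2 n\rfloor-1}.\end{cases}$$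
   Context: An algebra of subsets of $X$ is a family closed under complements, finite unions and finite intersections. For a family $\mathcal{U}$ of subsets of $X$, let $C_1(\mathcal{U})$ be the family of all sets of the form $E_1\cap E_2$, $E_1\cup E_2$ or $X\setminus E_1$ with $E_1,E_2\in\mathcal{U}$ (possibly $E_1=E_2$). Set $C_0(\mathcal{U})=\mathcal{U}$, $C_n(\mathcal{U})=C_1(C_{n-1}(\mathcal{U}))$ for $n\ge1$, and $C_\infty(\mathcal{U})=\bigcup_{n\ge1}C_n(\mathcal{U})$. A family $\mathcal{U}$ is $n$-minimal constructible ($n\ge1$) if for every proper subfamily $\mathcal{H}\subsetneq\mathcal{U}$ we have $\mathcal{U}\not\subseteq C_n(\mathcal{H})$. For families $\mathcal{U},\mathcal{H}$, $S_{\mathcal{U}}(\mathcal{H})=\inf\{n\ge0:\mathcal{H}\subseteq C_n(\mathcal{U})\}$ (with $\inf\emptyset=\infty$), the number of steps needed to construct $\mathcal{H}$ from $\mathcal{U}$. *)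

theory Defs
  imports "HOL-Analysis.Sigma_Algebra" "HOL-Library.Disjoint_Sets" "HOL-Library.Extended_Nat"
begin

definition constr_step :: "'a set \<Rightarrow> 'a set set \<Rightarrow> 'a set set" where
  "constr_step X U =
     {E1 \<inter> E2 | E1 E2. E1 \<in> U \<and> E2 \<in> U} \<union>
     {E1 \<union> E2 | E1 E2. E1 \<in> U \<and> E2 \<in> U} \<union>
     {X - E1 | E1. E1 \<in> U}"

primrec constr :: "'a set \<Rightarrow> nat \<Rightarrow> 'a set set \<Rightarrow> 'a set set" where
  "constr X 0 U = U"
| "constr X (Suc n) U = constr_step X (constr X n U)"

definition constr_inf :: "'a set \<Rightarrow> 'a set set \<Rightarrow> 'a set set" where
  "constr_inf X U = (\<Union>n\<in>{1..}. constr X n U)"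

definition minimal_constructible :: "'a set \<Rightarrow> nat \<Rightarrow> 'a set set \<Rightarrow> bool" where
  "minimal_constructible X n U \<longleftrightarrow> 1 \<le> n \<and> (\<forall>H. H \<subset> U \<longrightarrow> \<not> U \<subseteq> constr X n H)"

text \<open>In \<open>enat\<close> the infimum of the empty set is \<open>\<infinity>\<close>.\<close>

definition steps :: "'a set \<Rightarrow> 'a set set \<Rightarrow> 'a set set \<Rightarrow> enat" where
  "steps X U H = Inf {enat n | n. H \<subseteq> constr X n U}"

end

theory Submission imports Defs begin

text \<open>
  Let \<open>\<H>\<close> consist of the \<open>n\<close> atoms of \<open>\<A>\<close>. A member of \<open>\<A>\<close> is a union of a unique set of atoms, so only
  the numbers of atoms reachable in \<open>k\<close> steps matter. Unions at most double the size, and large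
  sizes arise by complementation, at the cost of one step. For \<open>k \<ge> 2\<close> the sizes reached in \<open>k\<close> steps are exactly
  the \<open>s\<close> with \<open>s \<le> 2\<^sup>k\<close> or \<open>s \<ge> n - 2\<^sup>k\<^sup>-\<^sup>1\<close>. They exhaust \<open>{0..n}\<close> iff
  \<open>n \<le> 1 + 3 \<cdot> 2\<^sup>k\<^sup>-\<^sup>1\<close>. One step never suffices, since it does not reach \<open>X\<close> itself.
\<close>

section \<open>Iterated construction\<close>

lemma constr_Int: "E \<in> constr X k U \<Longrightarrow> F \<in> constr X k U \<Longrightarrow> E \<inter> F \<in> constr X (Suc k) U"
  by (auto simp: constr_step_def)

lemma constr_Un: "E \<in> constr X k U \<Longrightarrow> F \<in> constr X k U \<Longrightarrow> E \<union> F \<in> constr X (Suc k) U"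
  by (auto simp: constr_step_def)

lemma constr_Diff: "E \<in> constr X k U \<Longrightarrow> X - E \<in> constr X (Suc k) U"
  by (auto simp: constr_step_def)

lemma constr_SucE [consumes 1, case_names Int Un Diff]:
  assumes "E \<in> constr X (Suc k) U"
  obtains (Int) E1 E2 where "E = E1 \<inter> E2" "E1 \<in> constr X k U" "E2 \<in> constr X k U"
  | (Un) E1 E2 where "E = E1 \<union> E2" "E1 \<in> constr X k U" "E2 \<in> constr X k U"
  | (Diff) E1 where "E = X - E1" "E1 \<in> constr X k U"
  using assms by (auto simp: constr_step_def)

text \<open>Since \<open>E = E \<inter> E\<close>, one further step keeps every set already
  constructed.\<close>

lemma constr_mono: "k \<le> l \<Longrightarrow> constr X k U \<subseteq> constr X l U"
proof (rule lift_Suc_mono_le[of "\<lambda>k. constr X k U"])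
  show "constr X j U \<subseteq> constr X (Suc j) U" for j
    using constr_Int[of _ X j U] by fastforce
qed

lemma (in algebra) constr_subset: "U \<subseteq> M \<Longrightarrow> constr \<Omega> k U \<subseteq> M"
proof (induction k)
  case (Suc k)
  show ?case
  proof
    fix E assume "E \<in> constr \<Omega> (Suc k) U"
    then show "E \<in> M"
      using Suc by (cases rule: constr_SucE) auto
  qed
qed simp

lemma steps_eqI:
  assumes "\<And>k. H \<subseteq> constr X k U \<longleftrightarrow> l \<le> k"
  shows "steps X U H = enat l"
  unfolding steps_def assms by (rule Inf_eqI) auto

section \<open>Unions of blocks of a partition\<close>

lemma partition_on_Union_Int:
  assumes "partition_on X H" "P \<subseteq> H" "Q \<subseteq> H"
  shows "\<Union>P \<inter> \<Union>Q = \<Union>(P \<inter> Q)"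
proof
  show "\<Union>P \<inter> \<Union>Q \<subseteq> \<Union>(P \<inter> Q)"
  proof clarify
    fix x p q assume "x \<in> p" "p \<in> P" "x \<in> q" "q \<in> Q"
    moreover from this have "p = q"
      using disjointD[OF partition_onD2[OF assms(1)], of p q] assms(2,3) by blast
    ultimately show "x \<in> \<Union>(P \<inter> Q)" by blast
  qed
qed blast

lemma partition_on_Union_Diff:
  assumes "partition_on X H" "P \<subseteq> H"
  shows "X - \<Union>P = \<Union>(H - P)"
proof -
  have "\<Union>P \<inter> \<Union>(H - P) = {}"
    using partition_on_Union_Int[OF assms, of "H - P"] by auto
  moreover have "X = \<Union>P \<union> \<Union>(H - P)"
    using partition_onD1[OF assms(1)] assms(2) by blast
  ultimately show ?thesis by blast
qed

text \<open>Blocks are nonempty and disjoint: a point of a block \<open>p \<in> P\<close> lies in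
  some block of \<open>Q\<close>, and that block can only be \<open>p\<close>. Hence a union
  determines its set of blocks, which makes counting blocks meaningful.\<close>

lemma partition_on_Union_subset_iff:
  assumes "partition_on X H" "P \<subseteq> H" "Q \<subseteq> H"
  shows "\<Union>P \<subseteq> \<Union>Q \<longleftrightarrow> P \<subseteq> Q"
proof
  assume sub: "\<Union>P \<subseteq> \<Union>Q"
  show "P \<subseteq> Q"
  proof
    fix p assume p: "p \<in> P"
    then have "p \<noteq> {}" using partition_onD3[OF assms(1)] assms(2) by auto
    then obtain x where "x \<in> p" by blast
    moreover from this p sub obtain q where "q \<in> Q" "x \<in> q" by blast
    ultimately show "p \<in> Q"
      using p disjointD[OF partition_onD2[OF assms(1)], of p q] assms(2,3) by blast
  qed
qed blast

lemma inj_on_Union_Pow_partition_on: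
  assumes "partition_on X H"
  shows "inj_on Union (Pow H)"
  using partition_on_Union_subset_iff[OF assms] by (intro inj_onI) (simp add: set_eq_subset)

lemma (in algebra) atoms_partition:
  assumes "finite M"
  obtains H where "partition_on \<Omega> H" "Union ` Pow H = M"
proof -
  \<comment> \<open>The least member of \<open>M\<close> around \<open>x\<close>; it belongs to
    \<open>M\<close> because \<open>M\<close> is finite.\<close>
  define atom where "atom x = \<Inter>{E \<in> M. x \<in> E}" for x
  have atom_in: "atom x \<in> M" if "x \<in> \<Omega>" for x
  proof -
    have "finite {E \<in> M. x \<in> E}" "{E \<in> M. x \<in> E} \<noteq> {}" "{E \<in> M. x \<in> E} \<subseteq> M"
      using assms that top by auto
    then show ?thesis
      unfolding atom_def using finite_INT[of "{E \<in> M. x \<in> E}" id] by auto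
  qed
  have mem: "x \<in> atom x" for x by (simp add: atom_def)
  have least: "atom x \<subseteq> E" if "E \<in> M" "x \<in> E" for x E
    using that by (auto simp: atom_def)
  have atom_eq: "atom y = atom x" if "y \<in> atom x" "x \<in> \<Omega>" for x y
  proof
    show sub: "atom y \<subseteq> atom x" using least[OF atom_in] that by blast
    have y: "y \<in> \<Omega>" using that atom_in sets_into_space by blast
    \<comment> \<open>Otherwise the complement of \<open>atom y\<close> is a member of
      \<open>M\<close> around \<open>x\<close>, so it contains \<open>atom x\<close> and with it
      \<open>y\<close>, which is absurd.\<close>
    have "x \<in> atom y"
    proof (rule ccontr)
      assume "x \<notin> atom y"
      then have "atom x \<subseteq> \<Omega> - atom y"
        using that y atom_in least by blast
      then show False using that mem by blast
    qed
    then show "atom x \<subseteq> atom y" using least[OF atom_in] y by blast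
  qed
  let ?H = "atom ` \<Omega>"
  have sub: "?H \<subseteq> M" using atom_in by blast
  have part: "partition_on \<Omega> ?H"
  proof (rule partition_onI)
    show "\<Union>?H = \<Omega>" using mem atom_in sets_into_space by blast
    show "disjnt p q" if "p \<in> ?H" "q \<in> ?H" "p \<noteq> q" for p q
    proof -
      obtain x y where "p = atom x" "x \<in> \<Omega>" "q = atom y" "y \<in> \<Omega>" using \<open>p \<in> ?H\<close> \<open>q \<in> ?H\<close> by blast
      then show ?thesis using \<open>p \<noteq> q\<close> unfolding disjnt_iff by (metis atom_eq)
    qed
    show "{} \<notin> ?H" using mem by blast
  qed
  moreover have "Union ` Pow ?H = M"
  proof (intro equalityI subsetI)
    fix E assume "E \<in> Union ` Pow ?H"
    then obtain P where P: "P \<subseteq> ?H" "E = \<Union>P" by blast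
    then have "finite P" "P \<subseteq> M" using sub assms by (auto intro: finite_subset)
    then show "E \<in> M" using P by blast
  next
    fix E assume E: "E \<in> M"
    then have "E = \<Union>(atom ` E)" using mem least by blast
    moreover have "atom ` E \<subseteq> ?H" using E sets_into_space by blast
    ultimately show "E \<in> Union ` Pow ?H" by blast
  qed
  ultimately show thesis by (rule that)
qed

section \<open>Sets constructible from a finite partition\<close>

text \<open>The invariant is "few blocks, or few blocks missing", and each operation keeps it while
  doubling both bounds. A union adds sizes and an intersection adds the numbers of missing blocks; a
  complement exchanges the two alternatives. The bound on missing blocks lags one step behind, since
  a complement costs a step. It is stated additively to avoid truncated subtraction.\<close>

lemma constr_partition_card:
  assumes "partition_on X H" "finite H" "E \<in> constr X (Suc k) H"
  shows "\<exists>P\<subseteq>H. E = \<Union>P \<and> (card P \<le> 2 ^ Suc k \<or> card H \<le> card P + 2 ^ k)"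
  using assms(3)
proof (induction k arbitrary: E)
  case 0
  note part = partition_on_Union_Int[OF assms(1)] partition_on_Union_Diff[OF assms(1)]
  from 0 show ?case
  proof (cases rule: constr_SucE)
    case (Int E1 E2)
    then have "E = \<Union>({E1} \<inter> {E2})" using part(1)[of "{E1}" "{E2}"] by simp
    moreover have "card ({E1} \<inter> {E2}) \<le> 2"
      by (rule order_trans[OF card_mono[of "{E1}"]]) auto
    moreover have "{E1} \<inter> {E2} \<subseteq> H" using Int by auto
    ultimately show ?thesis by (metis power_one_right One_nat_def)
  next
    case (Un E1 E2)
    then have "E = \<Union>{E1, E2}" "card {E1, E2} \<le> 2" "{E1, E2} \<subseteq> H"
      by (auto simp: card_insert_if)
    then show ?thesis by (metis power_one_right One_nat_def)
  next
    case (Diff E1)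
    then have "E = \<Union>(H - {E1})" "H - {E1} \<subseteq> H" using part(2)[of "{E1}"] by auto
    moreover have "card H \<le> card (H - {E1}) + 2 ^ 0"
      using assms(2) Diff by (simp add: card_Diff_singleton)
    ultimately show ?thesis by blast
  qed
next
  case (Suc k)
  have fin: "finite P" if "P \<subseteq> H" for P using that assms(2) by (rule finite_subset)
  from Suc.prems show ?case
  proof (cases rule: constr_SucE)
    case (Int E1 E2)
    obtain P Q where PQ: "P \<subseteq> H" "E1 = \<Union>P" "card P \<le> 2 ^ Suc k \<or> card H \<le> card P + 2 ^ k"
      "Q \<subseteq> H" "E2 = \<Union>Q" "card Q \<le> 2 ^ Suc k \<or> card H \<le> card Q + 2 ^ k"
      using Suc.IH[OF Int(2)] Suc.IH[OF Int(3)] by blast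
    \<comment> \<open>Inclusion-exclusion: \<open>P \<inter> Q\<close> misses at most as many blocks
      as \<open>P\<close> and \<open>Q\<close> miss together. This serves the case where both are
      large.\<close>
    have "card P + card Q \<le> card H + card (P \<inter> Q)"
      using card_Un_Int[OF fin[OF PQ(1)] fin[OF PQ(4)]] card_mono[OF assms(2), of "P \<union> Q"] PQ(1,4) by simp
    moreover have "card (P \<inter> Q) \<le> card P" "card (P \<inter> Q) \<le> card Q"
      using fin PQ(1,4) by (auto intro: card_mono)
    ultimately have "card (P \<inter> Q) \<le> 2 ^ Suc (Suc k) \<or> card H \<le> card (P \<inter> Q) + 2 ^ Suc k"
      using PQ(3,6) by auto
    moreover have "E = \<Union>(P \<inter> Q)"
      using Int(1) PQ partition_on_Union_Int[OF assms(1)] by simp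
    moreover have "P \<inter> Q \<subseteq> H" using PQ(1) by blast
    ultimately show ?thesis by blast
  next
    case (Un E1 E2)
    obtain P Q where PQ: "P \<subseteq> H" "E1 = \<Union>P" "card P \<le> 2 ^ Suc k \<or> card H \<le> card P + 2 ^ k"
      "Q \<subseteq> H" "E2 = \<Union>Q" "card Q \<le> 2 ^ Suc k \<or> card H \<le> card Q + 2 ^ k"
      using Suc.IH[OF Un(2)] Suc.IH[OF Un(3)] by blast
    have "card P \<le> card (P \<union> Q)" "card Q \<le> card (P \<union> Q)"
      using fin PQ(1,4) by (auto intro: card_mono)
    then have "card (P \<union> Q) \<le> 2 ^ Suc (Suc k) \<or> card H \<le> card (P \<union> Q) + 2 ^ Suc k"
      using PQ(3,6) card_Un_le[of P Q] by auto
    moreover have "E = \<Union>(P \<union> Q)" "P \<union> Q \<subseteq> H" using Un(1) PQ by auto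
    ultimately show ?thesis by blast
  next
    case (Diff E1)
    obtain P where P: "P \<subseteq> H" "E1 = \<Union>P" "card P \<le> 2 ^ Suc k \<or> card H \<le> card P + 2 ^ k"
      using Suc.IH[OF Diff(2)] by blast
    have "card (H - P) + card P = card H"
      using assms(2) P(1) fin by (simp add: card_Diff_subset card_mono)
    then have "card (H - P) \<le> 2 ^ Suc (Suc k) \<or> card H \<le> card (H - P) + 2 ^ Suc k"
      using P(3) by auto
    moreover have "E = \<Union>(H - P)"
      using Diff(1) P partition_on_Union_Diff[OF assms(1)] by simp
    ultimately show ?thesis by blast
  qed
qed

text \<open>Repeated halving: \<open>P\<close> splits into \<open>2 ^ k\<close> blocks and a
  remainder of at most \<open>2 ^ k\<close>, each built in \<open>k\<close> steps. An empty
  \<open>P\<close> is excluded because zero steps yield only blocks, never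
  \<open>{}\<close>.\<close>

lemma Union_in_constr:
  assumes "P \<subseteq> H" "finite P" "P \<noteq> {}" "card P \<le> 2 ^ k"
  shows "\<Union>P \<in> constr X k H"
  using assms
proof (induction k arbitrary: P)
  case 0
  then have "card P = 1" by (metis One_nat_def Suc_leI card_gt_0_iff le_antisym power_0)
  then show ?case using 0 by (auto simp: card_1_singleton_iff)
next
  case (Suc k)
  show ?case
  proof (cases "card P \<le> 2 ^ k")
    case True
    then have "\<Union>P \<in> constr X k H" using Suc by blast
    then show ?thesis using constr_mono[of k "Suc k" X H] by auto
  next
    case False
    then obtain Q where Q: "Q \<subseteq> P" "card Q = 2 ^ k" by (metis nat_le_linear obtain_subset_with_card_n)
    have fin: "finite Q" using Q Suc.prems finite_subset by blast
    have "card (P - Q) = card P - 2 ^ k" using Q fin by (simp add: card_Diff_subset)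
    then have "card (P - Q) \<le> 2 ^ k" "card (P - Q) \<noteq> 0"
      using False Suc.prems by auto
    then have "card (P - Q) \<le> 2 ^ k" "P - Q \<noteq> {}" by (simp, metis card.empty)
    moreover have "Q \<noteq> {}" using Q by auto
    ultimately have "\<Union>Q \<union> \<Union>(P - Q) \<in> constr X (Suc k) H"
      using Q Suc.prems fin by (intro constr_Un Suc.IH) auto
    moreover have "\<Union>Q \<union> \<Union>(P - Q) = \<Union>P" using Q by blast
    ultimately show ?thesis by simp
  qed
qed

lemma empty_in_constr_partition:
  assumes "partition_on X H" "2 \<le> card H"
  shows "{} \<in> constr X (Suc k) H"
proof -
  obtain p q where "p \<in> H" "q \<in> H" "p \<noteq> q"
    using assms(2) by (metis card_2_iff' obtain_subset_with_card_n subsetD)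
  then have "{} = p \<inter> q" using partition_onD2[OF assms(1)] by (auto simp: disjoint_def)
  then have "{} \<in> constr X 1 H" using \<open>p \<in> H\<close> \<open>q \<in> H\<close> constr_Int[of p X 0 H q] by simp
  then show ?thesis using constr_mono[of 1 "Suc k" X H] by auto
qed

text \<open>Two blocks cannot cover \<open>X\<close>, and no block is empty. This rules out a single
  step, which counting alone does not: \<open>X\<close> misses no block, and for three or four
  blocks the inequality \<open>card H \<le> 1 + 3 * 2 ^ (k - 1)\<close> already holds at
  \<open>k = 1\<close>.\<close>

lemma space_notin_constr_partition:
  assumes "partition_on X H" "finite H" "3 \<le> card H"
  shows "X \<notin> constr X 1 H"
proof
  note un = partition_onD1[OF assms(1)]
  have no: "\<not> X \<subseteq> p \<union> q" if "p \<in> H" "q \<in> H" for p q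
  proof
    assume "X \<subseteq> p \<union> q"
    then have "H \<subseteq> {p, q}"
      using un that partition_on_Union_subset_iff[OF assms(1), of H "{p, q}"] by simp
    then have "card H \<le> card {p, q}" by (intro card_mono) auto
    then show False using assms(3) by (auto simp: card_insert_if split: if_splits)
  qed
  assume "X \<in> constr X 1 H"
  then have "X \<in> constr X (Suc 0) H" by simp
  then show False
  proof (cases rule: constr_SucE)
    case (Int E1 E2)
    then show False using no[of E1 E2] by auto
  next
    case (Un E1 E2)
    then show False using no[of E1 E2] by auto
  next
    case (Diff E1)
    then have "E1 = {}" using un by auto
    then show False using Diff partition_onD3[OF assms(1)] by simp
  qed
qed

lemma constr_partition_full_iff:
  assumes "partition_on X H" "finite H" "3 \<le> card H"
  shows "Union ` Pow H \<subseteq> constr X k H \<longleftrightarrow> 2 \<le> k \<and> card H \<le> 1 + 3 * 2 ^ (k - 1)"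
proof
  assume full: "Union ` Pow H \<subseteq> constr X k H"
  have X: "X \<in> Union ` Pow H" using partition_onD1[OF assms(1)] by auto
  have k: "2 \<le> k"
  proof (rule ccontr)
    assume "\<not> 2 \<le> k"
    then have "constr X k H \<subseteq> constr X 1 H" by (intro constr_mono) auto
    then show False using full X space_notin_constr_partition[OF assms] by blast
  qed
  moreover have "card H \<le> 1 + 3 * 2 ^ (k - 1)"
  proof (rule ccontr)
    obtain j where j: "k = Suc j" using k by (cases k) auto
    assume "\<not> ?thesis"
    \<comment> \<open>The witness size \<open>2 ^ k + 1\<close> is the least one too large for
      unions; here it also misses more than \<open>2 ^ (k - 1)\<close> blocks, too many for a
      complement.\<close>
    then have big: "2 ^ k + 1 + 2 ^ j < card H" by (simp add: j)
    then obtain P where P: "P \<subseteq> H" "card P = 2 ^ k + 1"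
      by (meson add_leD1 less_imp_le obtain_subset_with_card_n)
    then have "\<Union>P \<in> constr X (Suc j) H" using full j by blast
    then obtain Q where Q: "Q \<subseteq> H" "\<Union>P = \<Union>Q" "card Q \<le> 2 ^ k \<or> card H \<le> card Q + 2 ^ j"
      unfolding j using constr_partition_card[OF assms(1,2), of "\<Union>P" j] by metis
    then have "P = Q"
      using inj_onD[OF inj_on_Union_Pow_partition_on[OF assms(1)] Q(2)] P by simp
    then show False using P(2) Q(3) big by (elim disjE) simp_all
  qed
  ultimately show "2 \<le> k \<and> card H \<le> 1 + 3 * 2 ^ (k - 1)" ..
next
  assume k: "2 \<le> k \<and> card H \<le> 1 + 3 * 2 ^ (k - 1)"
  then have "2 \<le> k" ..
  then obtain j where j: "k = Suc (Suc j)" by (metis Suc_le_D numeral_2_eq_2 Suc_le_mono)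
  have small: "\<Union>P \<in> constr X (Suc i) H" if "P \<subseteq> H" "card P \<le> 2 ^ Suc i" for P i
    using that assms empty_in_constr_partition[OF assms(1)] Union_in_constr[of P H "Suc i" X]
    by (cases "P = {}") (auto intro: finite_subset)
  show "Union ` Pow H \<subseteq> constr X k H"
  proof clarify
    fix P assume P: "P \<subseteq> H"
    show "\<Union>P \<in> constr X k H"
    proof (cases "card P \<le> 2 ^ k")
      case True
      then show ?thesis using small[of P "Suc j"] P by (simp only: j)
    next
      case False
      \<comment> \<open>More than \<open>2 ^ k\<close> of at most \<open>1 + 3 * 2 ^ (k - 1)\<close>
        blocks leave at most \<open>2 ^ (k - 1)\<close> others. Their union takes
        \<open>k - 1\<close> steps, and the last step is the complement.\<close>
      have "card (H - P) = card H - card P"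
        using P assms(2) by (simp add: card_Diff_subset finite_subset)
      then have "card (H - P) \<le> 2 ^ Suc j" using False k by (simp add: j)
      then have "X - \<Union>(H - P) \<in> constr X k H" unfolding j by (intro constr_Diff small) auto
      moreover have "X - \<Union>(H - P) = \<Union>P"
        using partition_on_Union_Diff[OF assms(1), of "H - P"] P by (simp add: double_diff)
      ultimately show ?thesis by simp
    qed
  qed
qed

lemma constr_inf_partition:
  assumes "partition_on X H" "finite H" "3 \<le> card H" "algebra X (Union ` Pow H)"
  shows "constr_inf X H = Union ` Pow H"
proof
  have "H \<subseteq> Union ` Pow H"
  proof
    fix p assume "p \<in> H"
    then show "p \<in> Union ` Pow H" by (intro image_eqI[of _ _ "{p}"]) auto
  qed
  then show "constr_inf X H \<subseteq> Union ` Pow H"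
    using algebra.constr_subset[OF assms(4)] unfolding constr_inf_def by blast
  \<comment> \<open>A crude number of steps is enough here: \<open>card H + 1\<close> meets the
    criterion.\<close>
  have "card H < 2 ^ card H" by (rule less_exp)
  then have "2 \<le> Suc (card H) \<and> card H \<le> 1 + 3 * 2 ^ (Suc (card H) - 1)"
    unfolding diff_Suc_1 using assms(3) by linarith
  then have "Union ` Pow H \<subseteq> constr X (Suc (card H)) H"
    by (simp only: constr_partition_full_iff[OF assms(1-3)])
  moreover have "constr X (Suc (card H)) H \<subseteq> constr_inf X H"
    unfolding constr_inf_def by (rule UN_upper) simp
  ultimately show "Union ` Pow H \<subseteq> constr_inf X H" by (rule order_trans)
qed

text \<open>A block \<open>a\<close> outside \<open>G\<close> is disjoint from all members of
  \<open>G\<close>, which are nonempty, so it is neither an intersection nor a union of two of them.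
  The complement of a block is a union of at least two blocks, hence not \<open>a\<close>.\<close>

lemma minimal_constructible_partition:
  assumes "partition_on X H" "3 \<le> card H"
  shows "minimal_constructible X 1 H"
  unfolding minimal_constructible_def
proof (intro conjI allI impI notI)
  fix G assume G: "G \<subset> H" "H \<subseteq> constr X 1 G"
  then obtain a where a: "a \<in> H" "a \<notin> G" by blast
  have dis: "a \<inter> p = {}" if "p \<in> H" "p \<noteq> a" for p
    using that a partition_onD2[OF assms(1)] by (auto simp: disjoint_def)
  have ne: "p \<noteq> {}" if "p \<in> H" for p using that partition_onD3[OF assms(1)] by metis
  have "a \<in> constr X (Suc 0) G" using a G by auto
  then show False
  proof (cases rule: constr_SucE)
    case (Int E1 E2)
    have "E1 \<noteq> a" "E1 \<in> H" using Int a G by auto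
    then have "a \<inter> E1 = {}" by (intro dis)
    then show False using Int(1) ne[OF a(1)] by auto
  next
    case (Un E1 E2)
    have "E1 \<noteq> a" "E1 \<in> H" using Un a G by auto
    then have "a \<inter> E1 = {}" "E1 \<noteq> {}" using dis ne by auto
    then show False using Un(1) by auto
  next
    case (Diff E1)
    then have E1: "{E1} \<subseteq> H" using G by auto
    have "\<Union>(H - {E1}) = \<Union>{a}"
      using Diff partition_on_Union_Diff[OF assms(1) E1] by simp
    then have "H - {E1} \<subseteq> {a}"
      using partition_on_Union_subset_iff[OF assms(1), of "H - {E1}" "{a}"] a by auto
    then have "H \<subseteq> {E1, a}" by blast
    then have "card H \<le> card {E1, a}" by (intro card_mono) auto
    then show False using assms(2) by (auto simp: card_insert_if split: if_splits)
  qed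
qed simp

section \<open>The number of steps\<close>

text \<open>Here \<open>L\<close> is the floor of the binary logarithm of \<open>n\<close>. Fewer
  than \<open>L\<close> steps never suffice and \<open>L + 1\<close> always do, because
  \<open>n < 2 ^ Suc L \<le> 1 + 3 * 2 ^ L\<close>; only \<open>L\<close> itself depends on the
  inequality.\<close>

lemma full_threshold_iff:
  fixes n L :: nat
  assumes "2 \<le> L" "2 ^ L \<le> n" "n < 2 ^ Suc L"
  shows "2 \<le> k \<and> n \<le> 1 + 3 * 2 ^ (k - 1) \<longleftrightarrow>
    (if n \<le> 1 + 3 * 2 ^ (L - 1) then L else Suc L) \<le> k"
proof -
  obtain l where l: "L = Suc (Suc l)" using assms(1) by (metis Suc_le_D numeral_2_eq_2 Suc_le_mono)
  have low: "\<not> (2 \<le> k \<and> n \<le> 1 + 3 * 2 ^ (k - 1))" if "k < L"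
  proof
    assume k: "2 \<le> k \<and> n \<le> 1 + 3 * 2 ^ (k - 1)"
    then have "(2::nat) ^ (k - 1) \<le> 2 ^ l" using that l by (intro power_increasing) auto
    \<comment> \<open>The strict inequality \<open>1 + 3 * m < 4 * m\<close> with
      \<open>m = 2 ^ l\<close> needs \<open>m \<ge> 2\<close>; it holds since
      \<open>2 \<le> k < L\<close> forces \<open>l \<ge> 1\<close>.\<close>
    moreover have "(2::nat) ^ 1 \<le> 2 ^ l" using that k l by (intro power_increasing) auto
    moreover have "(2::nat) ^ L = 4 * 2 ^ l" using l by simp
    ultimately show False using conjunct2[OF k] assms(2) unfolding power_one_right by linarith
  qed
  have mono: "n \<le> 1 + 3 * 2 ^ (k - 1)" if "n \<le> 1 + 3 * 2 ^ (j - 1)" "j \<le> k" for j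
  proof -
    have "(2::nat) ^ (j - 1) \<le> 2 ^ (k - 1)" using that by (intro power_increasing) auto
    then show ?thesis using that(1) by linarith
  qed
  have "n \<le> 1 + 3 * 2 ^ (Suc L - 1)" using assms(3) by simp
  then show ?thesis
    using low mono[of L] mono[of "Suc L"] assms(1) by (cases k L rule: linorder_cases) auto
qed

lemma log_threshold:
  fixes n L :: nat
  assumes "2 \<le> L" "2 ^ L \<le> n" "n < 2 ^ Suc L"
  shows "(if real n \<le> 1 + 3 * 2 powi (\<lfloor>log 2 (real n)\<rfloor> - 1)
      then enat (nat \<lfloor>log 2 (real n)\<rfloor>) else enat (nat \<lceil>log 2 (real n)\<rceil>))
    = enat (if n \<le> 1 + 3 * 2 ^ (L - 1) then L else Suc L)"
proof -
  have n: "0 < n" using assms(2) by (metis gr0I le_0_eq power_not_zero zero_neq_numeral)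
  have fl: "\<lfloor>log 2 (real n)\<rfloor> = int L"
    using floor_log_nat_eq_powr_iff[of 2 n L] assms n by simp
  have "int L - 1 = int (L - 1)" using assms(1) by simp
  then have pw: "2 powi (\<lfloor>log 2 (real n)\<rfloor> - 1) = real (2 ^ (L - 1))"
    unfolding fl by (simp del: of_nat_diff)
  have cond: "real n \<le> 1 + 3 * 2 powi (\<lfloor>log 2 (real n)\<rfloor> - 1) \<longleftrightarrow> n \<le> 1 + 3 * 2 ^ (L - 1)"
    unfolding pw using of_nat_le_iff[where 'a = real, of n "1 + 3 * 2 ^ (L - 1)"] by simp
  \<comment> \<open>An exact power \<open>n = 2 ^ L\<close> satisfies the inequality, so in this
    case \<open>n\<close> lies strictly between two powers of two and the ceiling is one more than
    the floor.\<close>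
  have "\<lceil>log 2 (real n)\<rceil> = int (Suc L)" if "\<not> n \<le> 1 + 3 * 2 ^ (L - 1)"
  proof -
    obtain l where "L = Suc l" using assms(1) by (cases L) auto
    then have "2 ^ L < n" using that by simp
    then show ?thesis using ceiling_log_nat_eq_powr_iff[of 2 n L] assms n by simp
  qed
  then show ?thesis unfolding cond using fl by (simp add: nat_add_distrib)
qed

text \<open>Four blocks make the floor of the logarithm at least 2. With three blocks the formula
  would give 1, although a single step does not reach \<open>X\<close>.\<close>

lemma steps_partition:
  assumes "partition_on X H" "finite H" "4 \<le> card H"
  shows "steps X H (Union ` Pow H) =
    (let n = real (card H) in
      if n \<le> 1 + 3 * 2 powi (\<lfloor>log 2 n\<rfloor> - 1)
      then enat (nat \<lfloor>log 2 n\<rfloor>) else enat (nat \<lceil>log 2 n\<rceil>))"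
proof -
  obtain L where L: "2 ^ L \<le> card H" "card H < 2 ^ Suc L"
    using ex_power_ivl1[of 2 "card H"] assms(3) by auto
  have "2 \<le> L"
  proof (rule ccontr)
    assume "\<not> 2 \<le> L"
    then have "(2::nat) ^ Suc L \<le> 2 ^ 2" by (intro power_increasing) auto
    then show False using L assms(3) by simp
  qed
  note L = this L
  have "3 \<le> card H" using assms(3) by simp
  then show ?thesis
    unfolding Let_def log_threshold[OF L]
    by (intro steps_eqI)
      (simp only: constr_partition_full_iff[OF assms(1,2)] full_threshold_iff[OF L])
qed

theorem theorem6p14:
  fixes X :: "'a set" and \<A> :: "'a set set"
  assumes "X \<noteq> {}"
    and "algebra X \<A>"
    and "finite \<A>"
    and "card \<A> \<ge> 2 ^ 4"
  shows "\<exists>\<H>. \<H> \<subseteq> Pow X \<and>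
           \<H> \<subseteq> \<A> \<and>
           partition_on X \<H> \<and>
           minimal_constructible X 1 \<H> \<and>
           constr_inf X \<H> = \<A> \<and>
           real (card \<H>) = log 2 (real (card \<A>)) \<and>
           (let n = real (card \<H>) in
              steps X \<H> \<A> =
                (if n \<le> 1 + 3 * 2 powi (\<lfloor>log 2 n\<rfloor> - 1)
                 then enat (nat \<lfloor>log 2 n\<rfloor>)
                 else enat (nat \<lceil>log 2 n\<rceil>)))"
proof -
  obtain H where H: "partition_on X H" "Union ` Pow H = \<A>"
    using algebra.atoms_partition[OF assms(2,3)] .
  have "H \<subseteq> \<A>"
  proof
    fix p assume "p \<in> H"
    then show "p \<in> \<A>" unfolding H(2)[symmetric] by (intro image_eqI[of _ _ "{p}"]) auto
  qed
  then have fin: "finite H" using assms(3) by (rule finite_subset)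
  \<comment> \<open>Members of the algebra correspond bijectively to sets of atoms, so the bound
    \<open>2 ^ 4\<close> becomes a bound of four on the number of atoms.\<close>
  have card: "card \<A> = 2 ^ card H"
    using card_image[OF inj_on_Union_Pow_partition_on[OF H(1)]] H(2) fin by (simp add: card_Pow)
  then have four: "4 \<le> card H" using assms(4) by (simp only: card power_increasing_iff)
  then have three: "3 \<le> card H" by simp
  have "H \<subseteq> Pow X" using partition_onD1[OF H(1)] by auto
  moreover have "real (card H) = log 2 (real (card \<A>))" unfolding card by simp
  moreover have "constr_inf X H = \<A>"
    using constr_inf_partition[OF H(1) fin three] H(2) assms(2) by simp
  ultimately show ?thesis
    using \<open>H \<subseteq> \<A>\<close> H(1) minimal_constructible_partition[OF H(1) three]
      steps_partition[OF H(1) fin four, unfolded H(2)]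
    by (intro exI[of _ H]) (simp add: Let_def)
qed

end
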